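(* Let $a \geq 2$ be an integer and define rational numbers $G_{n,a}$ ($n \in \mathbb{N}$) by the formal power series identity $$\frac{a t}{e^{(a-1)t} + e^{(a-2)t} + \dots + e^{t} + 1} = \sum_{n=0}^{\infty} G_{n,a} \frac{t^n}{n!}.$$ Then for every positive integer $n$, $G_{n,a}$ is an integer.
   Context: The identity is understood in the ring $\mathbb{Q}[[t]]$ of formal power series with rational coefficients. For $a=2$ the $G_{n,2}$ are the classical Genocchi numbers. *)

theory Defs
  imports Complex_Main "HOL-Computational_Algebra.Computational_Algebra"
begin

definition genocchi_gf :: "nat \<Rightarrow> rat fps" where
  "genocchi_gf a = of_nat a * fps_X / (\<Sum>j<a. fps_exp (of_nat j))"

definition genocchi :: "nat \<Rightarrow> nat \<Rightarrow> rat" where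
  "genocchi n a = fact n * fps_nth (genocchi_gf a) n"

(* The division is that of formal power series: the denominator has constant
   coefficient a, hence is a unit for a > 0. *)
lemma genocchi_gf_mult:
  assumes "a > 0"
  shows "genocchi_gf a * (\<Sum>j<a. fps_exp (of_nat j)) = of_nat a * fps_X"
proof -
  let ?D = "\<Sum>j<a. fps_exp (of_nat j :: rat)"
  have "fps_nth ?D 0 = of_nat a"
    by (simp add: fps_sum_nth)
  hence nz: "fps_nth ?D 0 \<noteq> 0"
    using assms by simp
  hence "is_unit ?D"
    by simp
  thus ?thesis
    unfolding genocchi_gf_def by (simp add: unit_div_mult_swap[symmetric] unit_imp_dvd)
qed

lemma genocchi_unique:
  "genocchi_gf a = Abs_fps (\<lambda>n. g n / fact n) \<longleftrightarrow> (\<forall>n. g n = genocchi n a)"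
  by (auto simp: genocchi_def fps_eq_iff field_simps)

end

theory Submission
  imports Defs
begin

text \<open>
  The denominator \<open>D\<close> of the generating function \<open>F\<close> is an exponential generating function of
  integers with constant term \<open>a\<close>, so solving \<open>F D = a t\<close> recursively shows that every \<open>G\<^sub>n\<close>
  lies in \<open>\<int>[1/a]\<close>. On the other hand, with \<open>U = e\<^sup>a\<^sup>t - 1\<close> one has \<open>D (e\<^sup>t - 1) = U\<close> and
  \<open>a t = ln (1 + U)\<close>, hence \<open>F = (e\<^sup>t - 1) (\<Sum>m. (-1)\<^sup>m U\<^sup>m / (m + 1))\<close>. The \<open>n\<close>-th
  exponential coefficient of \<open>U\<^sup>m\<close> is a multiple of \<open>a\<^sup>n\<close> and vanishes for \<open>n < m\<close>, and \<open>a\<^sup>m\<close>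
  absorbs the part of \<open>m + 1\<close> that is not coprime to \<open>a\<close>. So \<open>G\<^sub>n\<close> also has a denominator
  coprime to \<open>a\<close>, and is therefore an integer.
\<close>

section \<open>Products of exponential generating functions\<close>

lemma fact_mult_fps_mult_nth:
  fixes f g :: "'a :: field_char_0 fps"
  shows "fact n * fps_nth (f * g) n =
    (\<Sum>k\<le>n. of_nat (n choose k) * (fact k * fps_nth f k) * (fact (n - k) * fps_nth g (n - k)))"
proof -
  have "fact n * (fps_nth f k * fps_nth g (n - k)) =
      of_nat (n choose k) * (fact k * fps_nth f k) * (fact (n - k) * fps_nth g (n - k))"
    if "k \<le> n" for k
    using that by (simp add: binomial_fact)
  thus ?thesis
    unfolding fps_mult_nth sum_distrib_left atMost_atLeast0 by (intro sum.cong) auto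
qed

section \<open>Rationals with restricted denominators\<close>

definition power_denom :: "nat \<Rightarrow> rat set" where
  "power_denom a = {x. \<exists>m. of_nat a ^ m * x \<in> \<int>}"

text \<open>\<open>coprime 0 a\<close> holds only for \<open>a = 1\<close>. For every other
  \<open>a\<close> this set is the localisation of the integers at those coprime to
  \<open>a\<close>.\<close>

definition coprime_denom :: "nat \<Rightarrow> rat set" where
  "coprime_denom a = {x. \<exists>e. coprime e a \<and> of_nat e * x \<in> \<int>}"

lemma Ints_subset_power_denom: "x \<in> \<int> \<Longrightarrow> x \<in> power_denom a"
  unfolding power_denom_def by (auto intro!: exI[of _ 0])

lemma Ints_subset_coprime_denom: "x \<in> \<int> \<Longrightarrow> x \<in> coprime_denom a"
  unfolding coprime_denom_def by (auto intro!: exI[of _ 1])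

lemma power_denom_add:
  assumes "x \<in> power_denom a" "y \<in> power_denom a"
  shows "x + y \<in> power_denom a"
proof -
  obtain k l where k: "of_nat a ^ k * x \<in> \<int>" and l: "of_nat a ^ l * y \<in> \<int>"
    using assms unfolding power_denom_def by auto
  have "of_nat a ^ (k + l) * (x + y) =
      of_nat (a ^ l) * (of_nat a ^ k * x) + of_nat (a ^ k) * (of_nat a ^ l * y)"
    by (simp add: algebra_simps power_add)
  also have "\<dots> \<in> \<int>" by (intro Ints_add Ints_mult k l Ints_of_nat)
  finally show ?thesis unfolding power_denom_def by blast
qed

lemma coprime_denom_add:
  assumes "x \<in> coprime_denom a" "y \<in> coprime_denom a"
  shows "x + y \<in> coprime_denom a"
proof -
  obtain k l where k: "coprime k a" "of_nat k * x \<in> \<int>" and l: "coprime l a" "of_nat l * y \<in> \<int>"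
    using assms unfolding coprime_denom_def by auto
  have "of_nat (k * l) * (x + y) = of_nat l * (of_nat k * x) + of_nat k * (of_nat l * y)"
    by (simp add: algebra_simps)
  also have "\<dots> \<in> \<int>" by (intro Ints_add Ints_mult k l Ints_of_nat)
  finally show ?thesis using k l unfolding coprime_denom_def
    by (auto intro!: exI[of _ "k * l"])
qed

lemma power_denom_mult_Ints:
  assumes "x \<in> power_denom a" "y \<in> \<int>"
  shows "x * y \<in> power_denom a"
  using assms unfolding power_denom_def
  by (auto simp: mult.assoc[symmetric] intro: Ints_mult)

lemma coprime_denom_mult_Ints:
  assumes "x \<in> coprime_denom a" "y \<in> \<int>"
  shows "x * y \<in> coprime_denom a"
  using assms unfolding coprime_denom_def
  by (auto simp: mult.assoc[symmetric] intro: Ints_mult)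

lemma power_denom_sum:
  "(\<And>i. i \<in> A \<Longrightarrow> f i \<in> power_denom a) \<Longrightarrow> sum f A \<in> power_denom a"
  by (induction A rule: infinite_finite_induct)
     (auto intro: power_denom_add Ints_subset_power_denom)

lemma coprime_denom_sum:
  "(\<And>i. i \<in> A \<Longrightarrow> f i \<in> coprime_denom a) \<Longrightarrow> sum f A \<in> coprime_denom a"
  by (induction A rule: infinite_finite_induct)
     (auto intro: coprime_denom_add Ints_subset_coprime_denom)

lemma power_denom_cancel:
  assumes "of_nat a * x \<in> power_denom a"
  shows "x \<in> power_denom a"
proof -
  obtain m where "of_nat a ^ m * (of_nat a * x) \<in> \<int>"
    using assms unfolding power_denom_def by auto
  hence "of_nat a ^ Suc m * x \<in> \<int>" by (simp add: mult_ac)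
  thus ?thesis unfolding power_denom_def by blast
qed

text \<open>By Bezout for \<open>e\<close> and \<open>a ^ m\<close>, \<open>x\<close> is an integer
  combination of the integers \<open>e * x\<close> and \<open>a ^ m * x\<close>.\<close>

lemma Ints_if_power_coprime_denom:
  assumes "x \<in> power_denom a" "x \<in> coprime_denom a"
  shows "x \<in> \<int>"
proof -
  obtain m e where m: "of_nat a ^ m * x \<in> \<int>" and e: "coprime e a" "of_nat e * x \<in> \<int>"
    using assms unfolding power_denom_def coprime_denom_def by auto
  have "coprime (int e) (int (a ^ m))" using e(1) by simp
  then obtain u v where "u * int e + v * int (a ^ m) = 1"
    using bezout_int[of "int e" "int (a ^ m)"] by (auto simp: coprime_iff_gcd_eq_1)
  hence "of_int (u * int e + v * int (a ^ m)) = (1 :: rat)" by simp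
  hence "x = (of_int u * of_nat e + of_int v * of_nat a ^ m) * x" by simp
  also have "\<dots> = of_int u * (of_nat e * x) + of_int v * (of_nat a ^ m * x)"
    by (simp add: algebra_simps)
  also have "\<dots> \<in> \<int>" by (intro Ints_add Ints_mult m e Ints_of_int)
  finally show ?thesis .
qed

text \<open>Split off gcds with \<open>a\<close> repeatedly. Each nontrivial gcd costs one factor
  \<open>a\<close> and makes \<open>N\<close> strictly smaller, which bounds the exponent by
  \<open>N - 1\<close>. For \<open>N = Suc m\<close> this is the exponent of the power of
  \<open>U\<close> whose coefficient has to absorb the denominator \<open>m + 1\<close>.\<close>

lemma exists_coprime_cofactor:
  fixes N a :: nat
  assumes "N > 0"
  shows "\<exists>d e. N = d * e \<and> d dvd a ^ (N - 1) \<and> coprime e a"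
  using assms
proof (induction N rule: less_induct)
  case (less N)
  show ?case
  proof (cases "coprime N a")
    case True
    thus ?thesis by (intro exI[of _ 1] exI[of _ N]) auto
  next
    case False
    define g where "g = gcd N a"
    obtain N' where N': "N = g * N'" unfolding g_def by (metis dvd_def gcd_dvd1)
    have "g \<noteq> 1" using False by (auto simp: g_def coprime_iff_gcd_eq_1)
    moreover have "g > 0" "N' > 0" using less.prems N' by auto
    ultimately have "N' < N" using N' by simp
    from less.IH[OF this \<open>N' > 0\<close>] obtain d e
      where de: "N' = d * e" "d dvd a ^ (N' - 1)" "coprime e a" by blast
    have "g * d dvd a * a ^ (N' - 1)" using de(2) by (intro mult_dvd_mono) (auto simp: g_def)
    also have "\<dots> = a ^ N'" using \<open>N' > 0\<close> by (simp add: power_eq_if)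
    also have "\<dots> dvd a ^ (N - 1)" using \<open>N' < N\<close> by (intro le_imp_power_dvd) simp
    finally show ?thesis using de N' by (intro exI[of _ "g * d"] exI[of _ e]) auto
  qed
qed

text \<open>The factor \<open>d\<close> of \<open>Suc m\<close> divides \<open>a ^ m\<close>, hence
  \<open>a ^ n\<close>; after cancelling it, only the factor coprime to \<open>a\<close> remains
  below.\<close>

lemma power_over_Suc_in_coprime_denom:
  assumes "m \<le> n"
  shows "of_nat a ^ n / of_nat (Suc m) \<in> coprime_denom a"
proof -
  obtain d e where de: "Suc m = d * e" "d dvd a ^ m" "coprime e a"
    using exists_coprime_cofactor[of "Suc m" a] by auto
  have "d dvd a ^ n" using de(2) assms le_imp_power_dvd dvd_trans by blast
  then obtain q where q: "a ^ n = d * q" by blast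
  have nz: "of_nat d \<noteq> (0::rat)" "of_nat e \<noteq> (0::rat)" using de(1) by (auto intro: Nat.gr0I)
  have "of_nat e * (of_nat a ^ n / of_nat (Suc m)) = (of_nat q :: rat)"
    unfolding de(1) of_nat_power[symmetric] q using nz by simp
  thus ?thesis using de(3) unfolding coprime_denom_def
    by (intro CollectI exI[of _ e]) (simp del: of_nat_Suc)
qed

section \<open>Denominators from the recursion\<close>

lemma genocchi_in_power_denom:
  assumes "a > 0"
  shows "genocchi n a \<in> power_denom a"
proof (induction n rule: less_induct)
  case (less n)
  define D where "D = (\<Sum>j<a. fps_exp (of_nat j :: rat))"
  have D_nth: "fact k * fps_nth D k = (\<Sum>j<a. of_nat j ^ k)" for k
    by (simp add: D_def fps_sum_nth sum_distrib_left)
  have D_Ints: "fact k * fps_nth D k \<in> \<int>" for k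
    unfolding D_nth by (intro Ints_sum Ints_power Ints_of_nat)
  define c where "c k = of_nat (n choose k) * genocchi k a * (fact (n - k) * fps_nth D (n - k))" for k
  have "(\<Sum>k\<le>n. c k) = fact n * fps_nth (of_nat a * fps_X) n"
    unfolding c_def genocchi_def fact_mult_fps_mult_nth[symmetric]
    using genocchi_gf_mult[OF assms] by (simp add: D_def)
  moreover have "fact n * fps_nth (of_nat a * fps_X :: rat fps) n \<in> \<int>"
    by (auto simp: fps_of_nat[symmetric] le_Suc_eq simp del: fps_of_nat)
  ultimately have sum_Ints: "(\<Sum>k\<le>n. c k) \<in> \<int>" by simp
  \<comment> \<open>The constant term of \<open>D\<close> is \<open>a\<close>: the summand
    \<open>j = 0\<close> counts because \<open>0 ^ 0 = 1\<close>. Isolating the top term thus costs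
    one division by \<open>a\<close>.\<close>
  have "c n = of_nat a * genocchi n a"
    using D_nth[of 0] by (simp add: c_def)
  moreover have "(\<Sum>k\<le>n. c k) = c n + (\<Sum>k<n. c k)"
    by (simp add: lessThan_Suc_atMost[symmetric])
  ultimately have "of_nat a * genocchi n a = (\<Sum>k\<le>n. c k) + (\<Sum>k<n. c k) * (- 1)"
    by simp
  also have "\<dots> \<in> power_denom a"
  proof (rule power_denom_add[OF Ints_subset_power_denom[OF sum_Ints]],
      intro power_denom_mult_Ints power_denom_sum)
    fix k assume "k \<in> {..<n}"
    hence "genocchi k a * (of_nat (n choose k) * (fact (n - k) * fps_nth D (n - k))) \<in> power_denom a"
      by (intro power_denom_mult_Ints less.IH Ints_mult D_Ints Ints_of_nat) auto
    thus "c k \<in> power_denom a" by (simp add: c_def mult_ac)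
  qed auto
  finally show ?case by (rule power_denom_cancel)
qed

section \<open>Denominators from the logarithmic expansion\<close>

text \<open>The series is (e^t - 1)^m with t replaced by a t. One may take for \<open>z\<close> the
  number m! S(n, m), with S the Stirling numbers of the second kind; the induction on
  \<open>m\<close> only tracks integrality.\<close>

lemma fps_exp_minus_1_power_nth:
  "\<exists>z. fact n * fps_nth ((fps_exp (of_nat a :: rat) - 1) ^ m) n = of_nat a ^ n * of_int z"
proof (induction m arbitrary: n)
  case 0
  show ?case by (cases n) (auto intro: exI[of _ 1] exI[of _ 0])
next
  case (Suc m)
  define U where "U = fps_exp (of_nat a :: rat) - 1"
  obtain z where z: "fact k * fps_nth (U ^ m) k = of_nat a ^ k * of_int (z k)" for k
    using Suc unfolding U_def by metis
  have U: "fact k * fps_nth U k = of_nat a ^ k * of_int (if k = 0 then 0 else 1)" for k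
    by (simp add: U_def)
  have "fact n * fps_nth (U ^ Suc m) n =
      (\<Sum>k\<le>n. of_nat (n choose k) * (of_nat a ^ k * of_int (if k = 0 then 0 else 1)) *
        (of_nat a ^ (n - k) * of_int (z (n - k))))"
    unfolding power_Suc fact_mult_fps_mult_nth U z ..
  also have "\<dots> = (\<Sum>k\<le>n. of_nat a ^ n *
      of_int (int (n choose k) * (if k = 0 then 0 else 1) * z (n - k)))"
  proof (intro sum.cong refl)
    fix k assume "k \<in> {..n}"
    hence "(of_nat a :: rat) ^ n = of_nat a ^ k * of_nat a ^ (n - k)"
      by (simp add: power_add[symmetric])
    thus "of_nat (n choose k) * (of_nat a ^ k * of_int (if k = 0 then 0 else 1)) *
        (of_nat a ^ (n - k) * of_int (z (n - k))) = (of_nat a :: rat) ^ n *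
      of_int (int (n choose k) * (if k = 0 then 0 else 1) * z (n - k))" by simp
  qed
  also have "\<dots> = of_nat a ^ n * of_int (\<Sum>k\<le>n. int (n choose k) * (if k = 0 then 0 else 1) * z (n - k))"
    unfolding of_int_sum sum_distrib_left ..
  finally show ?case unfolding U_def by blast
qed

text \<open>The series ln (1 + t) / t.\<close>

definition fps_ln_over_X :: "rat fps" where
  "fps_ln_over_X = Abs_fps (\<lambda>m. (- 1) ^ m / of_nat (Suc m))"

lemma fps_ln_over_X_compose_exp:
  assumes "a > 0"
  shows "(fps_ln_over_X oo (fps_exp (of_nat a) - 1)) * (fps_exp (of_nat a) - 1) = of_nat a * fps_X"
proof -
  define U where "U = fps_exp (of_nat a :: rat) - 1"
  have U0: "fps_nth U 0 = 0" "fps_nth U 1 \<noteq> 0" using assms by (auto simp: U_def)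
  \<comment> \<open>\<open>fps_ln c\<close> is ln (1 + t) / c, the compositional inverse of
    \<open>fps_exp c - 1\<close>; the factor \<open>a\<close> removes this normalisation.\<close>
  have "fps_ln_over_X * fps_X = of_nat a * fps_ln (of_nat a)"
    using assms
    by (auto simp: fps_eq_iff fps_ln_over_X_def fps_ln_def fps_of_nat[symmetric] Suc_diff_le
             simp del: fps_of_nat split: nat.splits)
  hence "(fps_ln_over_X * fps_X) oo U = (of_nat a * fps_ln (of_nat a)) oo U" by simp
  hence "(fps_ln_over_X oo U) * U = of_nat a * (fps_ln (of_nat a) oo U)"
    using U0 by (simp add: fps_compose_mult_distrib fps_of_nat[symmetric] del: fps_of_nat)
  also have "fps_ln (of_nat a) oo U = fps_X"
    using fps_ln_fps_exp_inv[of "of_nat a :: rat"] fps_inv[OF U0] assms by (simp add: U_def)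
  finally show ?thesis by (simp add: U_def)
qed

text \<open>By the geometric sum, D (e^t - 1) = U. Both sides therefore agree after multiplication
  by \<open>U\<close>, which is nonzero and cancels in the integral domain of power series.\<close>

lemma genocchi_gf_eq:
  assumes "a > 0"
  shows "genocchi_gf a = (fps_ln_over_X oo (fps_exp (of_nat a) - 1)) * (fps_exp 1 - 1)"
proof -
  define U where "U = fps_exp (of_nat a :: rat) - 1"
  define D where "D = (\<Sum>j<a. fps_exp (of_nat j :: rat))"
  have "fps_nth U 1 \<noteq> 0" using assms by (simp add: U_def)
  hence "U \<noteq> 0" by auto
  have "D * (fps_exp 1 - 1) = U"
    using power_diff_1_eq[of "fps_exp (1::rat)" a]
    by (simp add: D_def U_def fps_exp_power_mult mult.commute)
  hence "genocchi_gf a * U = genocchi_gf a * D * (fps_exp 1 - 1)" by (simp add: mult.assoc)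
  also have "\<dots> = (fps_ln_over_X oo U) * (fps_exp 1 - 1) * U"
    using genocchi_gf_mult[OF assms] fps_ln_over_X_compose_exp[OF assms]
    by (simp add: D_def U_def mult_ac)
  finally show ?thesis using \<open>U \<noteq> 0\<close> by (simp add: U_def)
qed

lemma genocchi_in_coprime_denom:
  assumes "a > 0"
  shows "genocchi n a \<in> coprime_denom a"
proof -
  define U where "U = fps_exp (of_nat a :: rat) - 1"
  have W: "fact k * fps_nth (fps_ln_over_X oo U) k \<in> coprime_denom a" for k
  proof -
    \<comment> \<open>The \<open>k\<close>-th coefficient of the composition involves only powers
      with \<open>m \<le> k\<close>, so \<open>a ^ k\<close> suffices to absorb the part of
      \<open>m + 1\<close> not coprime to \<open>a\<close>.\<close>
    have "fact k * (fps_nth fps_ln_over_X m * fps_nth (U ^ m) k) \<in> coprime_denom a" if "m \<le> k" for m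
    proof -
      obtain z where "fact k * fps_nth (U ^ m) k = of_nat a ^ k * of_int z"
        using fps_exp_minus_1_power_nth unfolding U_def by blast
      hence "fact k * (fps_nth fps_ln_over_X m * fps_nth (U ^ m) k) =
          of_nat a ^ k / of_nat (Suc m) * ((- 1) ^ m * of_int z)"
        by (simp add: fps_ln_over_X_def field_simps)
      also have "\<dots> \<in> coprime_denom a"
        by (intro coprime_denom_mult_Ints power_over_Suc_in_coprime_denom that) auto
      finally show ?thesis .
    qed
    thus ?thesis
      unfolding fps_compose_nth sum_distrib_left by (intro coprime_denom_sum) auto
  qed
  have V: "fact k * fps_nth (fps_exp 1 - 1 :: rat fps) k \<in> \<int>" for k by simp
  have "genocchi n a = (\<Sum>k\<le>n. of_nat (n choose k) * (fact k * fps_nth (fps_ln_over_X oo U) k) *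
      (fact (n - k) * fps_nth (fps_exp 1 - 1) (n - k)))"
    unfolding genocchi_def genocchi_gf_eq[OF assms] U_def[symmetric] fact_mult_fps_mult_nth ..
  also have "\<dots> \<in> coprime_denom a"
  proof (intro coprime_denom_sum)
    fix k
    have "fact k * fps_nth (fps_ln_over_X oo U) k *
        (of_nat (n choose k) * (fact (n - k) * fps_nth (fps_exp 1 - 1) (n - k))) \<in> coprime_denom a"
      by (intro coprime_denom_mult_Ints W V Ints_mult Ints_of_nat)
    thus "of_nat (n choose k) * (fact k * fps_nth (fps_ln_over_X oo U) k) *
      (fact (n - k) * fps_nth (fps_exp 1 - 1) (n - k)) \<in> coprime_denom a"
      by (simp only: mult_ac)
  qed
  finally show ?thesis .
qed

theorem theorem1:
  fixes a n :: nat
  assumes "a \<ge> 2" and "n > 0"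
  shows "genocchi n a \<in> \<int>"
  using assms
  by (intro Ints_if_power_coprime_denom[of _ a] genocchi_in_power_denom genocchi_in_coprime_denom) auto

end
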